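(* There exist sets $Z\subset\mathbb{R}^2$ and $E\subset\mathbb{R}^2$ such that $|\mathbb{R}^2\setminus E|=0$, the characteristic function $\chi_Z:\mathbb{R}^2\to\{0,1\}$ of $Z$ is differentiable in almost every direction at each point of $E$, and $\chi_Z$ is nowhere Lipschitz relative to $E$ (that is, there is no point $x\in\mathbb{R}^2$ at which $\chi_Z$ is Lipschitz relative to $E$).
   Context: Notation: $|A|$ denotes the Lebesgue measure of $A\subset\mathbb{R}^2$, $\|\cdot\|$ is the Euclidean norm on $\mathbb{R}^2$, and $\mathbb{S}^1$ is the unit circle. Directional differentiability: for $f:\mathbb{R}^2\to\mathbb{R}$, $x\in\mathbb{R}^2$ and $u\in\mathbb{S}^1$, the function $f$ is differentiable at $x$ in direction $u$ if the limit $\lim_{h\to0+}\frac{f(x+hu)-f(x)}{h}$ exists and is finite. We say that $f$ is differentiable at $x$ in almost every direction if the set $\{u\in\mathbb{S}^1: f\text{ is not differentiable at }x\text{ in direction }u\}$ has zero one-dimensional Hausdorff measure $\mathcal{H}^1$ in $\mathbb{S}^1$. Relative Lipschitz property: for $M\subset\mathbb{R}^2$ and $x\in\mathbb{R}^2$, we say that $f$ is Lipschitz at $x$ relative to $M$ if $x$ is not a limit point of $M$ or $$\limsup_{y\to x,\,y\in M}\frac{|f(y)-f(x)|}{\|y-x\|}<\infty$$ (the limsup is over $y\neq x$). The point $x$ itself is not required to belong to $M$. *)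

theory Defs
  imports "HOL-Analysis.Analysis"
begin

text \<open>One-dimensional Hausdorff (outer) measure, by Caratheodory's construction: the supremum over
  \<open>\<delta> > 0\<close> of the infimum of \<open>\<Sum>i. diam (U i)\<close> over countable covers by sets of diameter at most
  \<open>\<delta>\<close>. The library's real-valued \<^const>\<open>diameter\<close> is unspecified on unbounded sets, whence
  the boundedness requirement. The empty set has diameter \<open>0\<close>, so finite covers are included.\<close>

definition hausdorff1_pre :: "real \<Rightarrow> 'a::metric_space set \<Rightarrow> ennreal" where
  "hausdorff1_pre \<delta> A =
     (INF U \<in> {U :: nat \<Rightarrow> 'a set. A \<subseteq> (\<Union>i. U i) \<and> (\<forall>i. bounded (U i) \<and> diameter (U i) \<le> \<delta>)}.
        \<Sum>i. ennreal (diameter (U i)))"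

definition hausdorff1 :: "'a::metric_space set \<Rightarrow> ennreal" where
  "hausdorff1 A = (SUP \<delta> \<in> {0<..}. hausdorff1_pre \<delta> A)"

definition dir_differentiable :: "('a::real_normed_vector \<Rightarrow> real) \<Rightarrow> 'a \<Rightarrow> 'a \<Rightarrow> bool" where
  "dir_differentiable f x u \<longleftrightarrow>
     (\<exists>l. ((\<lambda>h. (f (x + h *\<^sub>R u) - f x) / h) \<longlongrightarrow> l) (at_right 0))"

definition differentiable_ae_direction :: "(real ^ 2 \<Rightarrow> real) \<Rightarrow> real ^ 2 \<Rightarrow> bool" where
  "differentiable_ae_direction f x \<longleftrightarrow>
     hausdorff1 {u \<in> sphere 0 1. \<not> dir_differentiable f x u} = 0"

text \<open>The filter \<^term>\<open>at x within M\<close> is punctured at \<open>x\<close>, whether or not \<open>x \<in> M\<close>.\<close>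

definition lipschitz_at_relative ::
    "('a::real_normed_vector \<Rightarrow> real) \<Rightarrow> 'a \<Rightarrow> 'a set \<Rightarrow> bool" where
  "lipschitz_at_relative f x M \<longleftrightarrow>
     \<not> x islimpt M \<or>
     Limsup (at x within M) (\<lambda>y. ereal (\<bar>f y - f x\<bar> / norm (y - x))) < \<infinity>"

end

theory Submission
  imports Defs
begin

text \<open>Let \<open>B k\<close> be balls with dense centres \<open>c k\<close> and rapidly decreasing radii \<open>r k \<le> 4\<^sup>-\<^sup>k\<close>, and
  let \<open>Z\<close> consist of the points that lie in an odd number of them. By Borel--Cantelli, almost
  every \<open>x\<close> satisfies \<open>dist x (c k) \<ge> 2\<^sup>-\<^sup>k\<close> for all but finitely many \<open>k\<close>. For these \<open>k\<close> the
  directions in which \<open>B k\<close> is seen from \<open>x\<close> form an arc of length at most a constant times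
  \<open>2\<^sup>-\<^sup>k\<close>, so, by Borel--Cantelli on the circle, the ray from \<open>x\<close> in almost every direction meets
  only finitely many \<open>B k\<close> not containing \<open>x\<close>. If moreover \<open>x\<close> is on no boundary circle (which defines \<open>E\<close>), the
  characteristic function of \<open>Z\<close> is constant on an initial piece of such a ray.

  If the radii decrease so fast that the ball of radius \<open>2 * r k\<close> around \<open>c k\<close> misses all earlier
  circles, then the earlier balls contribute a constant parity on it, which \<open>B k\<close> flips on one
  part only, and the later balls are too small to cover either part. Hence both \<open>E \<inter> Z\<close>
  and \<open>E - Z\<close> are dense, which excludes the relative Lipschitz property everywhere.\<close>

text \<open>Borel-Cantelli for \<open>hausdorff1\<close>: every tail of the sequence of balls still
  covers \<open>A\<close>. A tail sum below \<open>min \<delta> \<epsilon> / 2\<close> keeps each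
  diameter below \<open>\<delta>\<close> and their sum below \<open>\<epsilon>\<close> at
  once.\<close>

lemma hausdorff1_limsup_cball_eq_0:
  fixes c :: "nat \<Rightarrow> 'a::real_normed_vector"
  assumes \<rho>: "summable \<rho>" "\<And>k. 0 \<le> \<rho> k"
    and A: "\<And>a. a \<in> A \<Longrightarrow> infinite {k. a \<in> cball (c k) (\<rho> k)}"
  shows "hausdorff1 A = 0"
proof -
  have "hausdorff1_pre \<delta> A \<le> ennreal \<epsilon>" if "0 < \<delta>" "0 < \<epsilon>" for \<delta> \<epsilon>
  proof -
    have "(\<lambda>n. \<Sum>k. \<rho> (k + n)) \<longlonglongrightarrow> 0"
      using suminf_exist_split2[OF \<rho>(1)] .
    then have "\<forall>\<^sub>F n in sequentially. (\<Sum>k. \<rho> (k + n)) < min \<delta> \<epsilon> / 2"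
      using that by (intro order_tendstoD) auto
    then obtain n where n: "(\<Sum>k. \<rho> (k + n)) < min \<delta> \<epsilon> / 2"
      by (auto simp: eventually_sequentially)
    have sm: "summable (\<lambda>k. \<rho> (k + n))"
      using \<rho>(1) by (rule summable_ignore_initial_segment)
    define U where "U k = cball (c (k + n)) (\<rho> (k + n))" for k
    have diam: "diameter (U k) \<le> 2 * \<rho> (k + n)" for k
    proof (rule diameter_le)
      fix y z assume "y \<in> U k" "z \<in> U k"
      then show "norm (y - z) \<le> 2 * \<rho> (k + n)"
        using dist_triangle3[of y z "c (k + n)"] by (auto simp: U_def dist_norm)
    qed (use \<rho> in auto)
    have small: "\<rho> (k + n) \<le> (\<Sum>k. \<rho> (k + n))" for k
      using sum_le_suminf[OF sm, of "{k}"] \<rho>(2) by auto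
    have bd: "diameter (U k) \<le> \<delta>" for k
      using diam[of k] small[of k] n by auto
    have "A \<subseteq> (\<Union>k. U k)"
    proof
      fix a assume "a \<in> A"
      then obtain k where "k \<ge> n" "a \<in> cball (c k) (\<rho> k)"
        using A unfolding infinite_nat_iff_unbounded_le by blast
      then have "a \<in> U (k - n)" by (simp add: U_def)
      then show "a \<in> (\<Union>k. U k)" by blast
    qed
    then have "hausdorff1_pre \<delta> A \<le> (\<Sum>k. ennreal (diameter (U k)))"
      unfolding hausdorff1_pre_def using bd by (intro INF_lower) (auto simp: U_def)
    also have "\<dots> \<le> (\<Sum>k. ennreal (2 * \<rho> (k + n)))"
      using diam by (intro suminf_le ennreal_leI) auto
    also have "\<dots> = ennreal (2 * (\<Sum>k. \<rho> (k + n)))"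
      using sm \<rho>(2) by (subst suminf_ennreal2) (auto intro: summable_mult simp: suminf_mult)
    also have "\<dots> \<le> ennreal \<epsilon>"
      using n by (intro ennreal_leI) auto
    finally show ?thesis .
  qed
  then have "hausdorff1_pre \<delta> A = 0" if "0 < \<delta>" for \<delta>
    using that by (metis ennreal_le_epsilon add_0 le_zero_eq zero_le)
  then show ?thesis
    unfolding hausdorff1_def by simp
qed

text \<open>After scaling by \<open>norm w\<close>, the difference splits into a radial correction
  along \<open>sgn v\<close> and \<open>v - w\<close>; each has norm at most
  \<open>norm (v - w)\<close>.\<close>

lemma norm_sgn_diff_le:
  fixes v w :: "'a::real_normed_vector"
  assumes "w \<noteq> 0"
  shows "norm (sgn v - sgn w) \<le> 2 * norm (v - w) / norm w"
proof -
  have "norm w *\<^sub>R (sgn v - sgn w) = (norm w - norm v) *\<^sub>R sgn v + (v - w)"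
    by (cases "v = 0") (simp_all add: algebra_simps sgn_div_norm assms)
  then have "norm w * norm (sgn v - sgn w) = norm ((norm w - norm v) *\<^sub>R sgn v + (v - w))"
    by (metis abs_norm_cancel norm_scaleR)
  also have "\<dots> \<le> norm ((norm w - norm v) *\<^sub>R sgn v) + norm (v - w)"
    by (rule norm_triangle_ineq)
  also have "norm ((norm w - norm v) *\<^sub>R sgn v) \<le> norm (v - w)"
    using norm_triangle_ineq3[of v w] by (auto simp: norm_sgn)
  finally show ?thesis
    using assms by (simp add: field_simps)
qed

text \<open>Both \<open>h *\<^sub>R u\<close> and \<open>c - x\<close> are normalized; dividing by
  the length of the latter makes the bound independent of \<open>h\<close>.\<close>

lemma direction_hitting_ball:
  fixes u x c :: "'a::real_normed_vector"
  assumes "norm u = 1" "0 < h" "x + h *\<^sub>R u \<in> ball c r" "c \<noteq> x"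
  shows "u \<in> cball (sgn (c - x)) (2 * r / dist x c)"
proof -
  have "sgn (h *\<^sub>R u) = u"
    using assms by (simp add: sgn_div_norm)
  moreover have "norm (h *\<^sub>R u - (c - x)) < r"
    using assms(3) by (simp add: dist_norm norm_minus_commute algebra_simps)
  then have "2 * norm (h *\<^sub>R u - (c - x)) / norm (c - x) \<le> 2 * r / norm (c - x)"
    by (intro divide_right_mono) auto
  ultimately show ?thesis
    using norm_sgn_diff_le[of "c - x" "h *\<^sub>R u"] assms(4)
    by (simp add: dist_norm norm_minus_commute)
qed

lemma eventually_ray_mem_ball_iff:
  fixes x u c :: "'a::real_normed_vector"
  assumes "x \<notin> sphere c r"
  shows "\<forall>\<^sub>F h in at_right 0. x + h *\<^sub>R u \<in> ball c r \<longleftrightarrow> x \<in> ball c r"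
proof -
  have lim: "((\<lambda>h. dist c (x + h *\<^sub>R u)) \<longlongrightarrow> dist c (x + 0 *\<^sub>R u)) (at_right 0)"
    by (intro tendsto_intros)
  show ?thesis
  proof (cases "dist c x < r")
    case True
    then show ?thesis using order_tendstoD(2)[OF lim, of r] by (auto elim: eventually_mono)
  next
    case False
    then have "r < dist c x" using assms by auto
    then show ?thesis using order_tendstoD(1)[OF lim, of r] by (auto elim: eventually_mono)
  qed
qed

text \<open>Arbitrarily close to \<open>x\<close> there are points of \<open>E\<close> other than
  \<open>x\<close> where the indicator differs from its value at \<open>x\<close> by 1, so the
  quotient there is \<open>1 / norm (y - x)\<close>, which is unbounded.\<close>

lemma not_lipschitz_at_relative_if_dense:
  fixes Z E :: "'a::{real_normed_vector,perfect_space} set"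
  assumes dense: "\<And>V. open V \<Longrightarrow> V \<noteq> {} \<Longrightarrow> V \<inter> E \<inter> Z \<noteq> {} \<and> V \<inter> E - Z \<noteq> {}"
  shows "\<not> lipschitz_at_relative (indicat_real Z) x E"
proof
  assume "lipschitz_at_relative (indicat_real Z) x E"
  moreover have near: "\<exists>y\<in>E. y \<noteq> x \<and> dist y x < d \<and> indicat_real Z y \<noteq> indicat_real Z x"
    if "0 < d" for d
  proof -
    have "ball x d - {x} \<noteq> {}"
      using that by (metis Diff_cancel ball_eq_empty cball_trivial finite.emptyI finite.insertI
          finite_Diff2 finite_imp_not_open not_le open_ball)
    then have "(ball x d - {x}) \<inter> E \<inter> Z \<noteq> {} \<and> (ball x d - {x}) \<inter> E - Z \<noteq> {}"
      by (intro dense open_delete) auto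
    then show ?thesis
      by (cases "x \<in> Z") (fastforce simp: dist_commute)+
  qed
  moreover have "x islimpt E"
    unfolding islimpt_approachable using near by blast
  ultimately have "Limsup (at x within E) (\<lambda>y. ereal (\<bar>indicat_real Z y - indicat_real Z x\<bar> / norm (y - x))) < \<infinity>"
    by (simp add: lipschitz_at_relative_def)
  then obtain C where "Limsup (at x within E) (\<lambda>y. ereal (\<bar>indicat_real Z y - indicat_real Z x\<bar> / norm (y - x))) < ereal C"
    using less_PInf_Ex_of_nat by (metis ereal_dense2)
  then have "\<forall>\<^sub>F y in at x within E. \<bar>indicat_real Z y - indicat_real Z x\<bar> / norm (y - x) < C"
    by (auto dest!: Limsup_lessD)
  then obtain d where "0 < d"
    and d: "\<And>y. y \<in> E \<Longrightarrow> y \<noteq> x \<Longrightarrow> dist y x < d \<Longrightarrow>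
              \<bar>indicat_real Z y - indicat_real Z x\<bar> / norm (y - x) < C"
    by (auto simp: eventually_at)
  obtain y where y: "y \<in> E" "y \<noteq> x" "dist y x < min d (1 / (\<bar>C\<bar> + 1))"
      "indicat_real Z y \<noteq> indicat_real Z x"
    using near[of "min d (1 / (\<bar>C\<bar> + 1))"] \<open>0 < d\<close> by (auto simp: add_nonneg_pos)
  then have "1 / norm (y - x) < C"
    using d[of y] by (cases "y \<in> Z"; cases "x \<in> Z") auto
  moreover have "\<bar>C\<bar> + 1 < 1 / norm (y - x)"
    using y by (auto simp: dist_norm field_simps)
  ultimately show False by linarith
qed

lemma exists_generic_radii:
  fixes x :: "nat \<Rightarrow> 'a::metric_space"
  obtains r :: "nat \<Rightarrow> real"
  where "\<And>k. 0 < r k" "\<And>k. r k \<le> (1/4) ^ k"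
    "\<And>j k. j < k \<Longrightarrow> r k \<le> r j * (1/4) ^ (k - j)"
    "\<And>j k. j < k \<Longrightarrow> 2 * r k < \<bar>dist (x k) (x j) - r j\<bar>"
proof -
  \<comment> \<open>The separation from earlier spheres can be met only if no centre lies on one.
    Hence each radius also avoids its countably many distances to all centres, those of later balls
    included.\<close>
  define P where "P r k \<rho> \<longleftrightarrow> 0 < \<rho> \<and> \<rho> \<le> (1/4) ^ k \<and> \<rho> \<notin> range (\<lambda>m. dist (x m) (x k)) \<and>
      (\<forall>j<k. \<rho> \<le> r j * (1/4) ^ (k - j) \<and> 2 * \<rho> < \<bar>dist (x k) (x j) - r j\<bar>)"
    for r :: "nat \<Rightarrow> real" and k \<rho>
  have "\<exists>r. \<forall>k. P r k (r k)"
  proof (rule dependent_wf_choice[OF wf_less_than])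
    fix f g :: "nat \<Rightarrow> real" and k \<rho>
    assume "\<And>j. (j, k) \<in> less_than \<Longrightarrow> f j = g j"
    then show "P f k \<rho> = P g k \<rho>" by (simp add: P_def)
  next
    fix k and r :: "nat \<Rightarrow> real"
    assume IH: "\<And>j. (j, k) \<in> less_than \<Longrightarrow> P r j (r j)"
    have lim: "((\<lambda>\<rho>::real. \<rho>) \<longlongrightarrow> 0) (at_right 0)" "((\<lambda>\<rho>::real. 2 * \<rho>) \<longlongrightarrow> 2 * 0) (at_right 0)"
      by (intro tendsto_intros)+
    have "\<forall>\<^sub>F \<rho> in at_right 0. \<rho> < r j * (1/4) ^ (k - j) \<and> 2 * \<rho> < \<bar>dist (x k) (x j) - r j\<bar>"
      if "j < k" for j
    proof -
      have "0 < r j" "r j \<noteq> dist (x k) (x j)" using IH[of j] that by (auto simp: P_def)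
      then show ?thesis
        by (intro eventually_conj order_tendstoD(2)[OF lim(1)] order_tendstoD(2)[OF lim(2)]) auto
    qed
    then have "\<forall>\<^sub>F \<rho> in at_right 0. \<forall>j\<in>{..<k}. \<rho> < r j * (1/4) ^ (k - j) \<and> 2 * \<rho> < \<bar>dist (x k) (x j) - r j\<bar>"
      by (intro eventually_ball_finite) auto
    moreover have "\<forall>\<^sub>F \<rho> in at_right 0. \<rho> < (1/4::real) ^ k"
      by (intro order_tendstoD(2)[OF lim(1)]) auto
    ultimately have "\<forall>\<^sub>F \<rho> in at_right 0. (\<forall>j\<in>{..<k}. \<rho> < r j * (1/4) ^ (k - j) \<and> 2 * \<rho> < \<bar>dist (x k) (x j) - r j\<bar>)
        \<and> \<rho> < (1/4) ^ k"
      by (rule eventually_conj)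
    then obtain b where "0 < b" and b: "\<And>\<rho>. 0 < \<rho> \<Longrightarrow> \<rho> < b \<Longrightarrow>
        (\<forall>j\<in>{..<k}. \<rho> < r j * (1/4) ^ (k - j) \<and> 2 * \<rho> < \<bar>dist (x k) (x j) - r j\<bar>) \<and> \<rho> < (1/4) ^ k"
      unfolding eventually_at_right_field by blast
    \<comment> \<open>All other requirements hold on a whole interval, which the forbidden distances
      cannot exhaust.\<close>
    have "uncountable ({0<..<b} - range (\<lambda>m. dist (x m) (x k)))"
      using \<open>0 < b\<close> by (intro uncountable_minus_countable) (auto simp: uncountable_open_interval)
    then obtain \<rho> where "\<rho> \<in> {0<..<b} - range (\<lambda>m. dist (x m) (x k))"
      by (metis countable_empty ex_in_conv)
    then show "\<exists>\<rho>. P r k \<rho>"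
      using b[of \<rho>] unfolding P_def by (intro exI[of _ \<rho>]) (auto intro: less_imp_le)
  qed
  then obtain r where "\<And>k. P r k (r k)" by blast
  then show thesis by (intro that[of r]) (auto simp: P_def)
qed

text \<open>A comparison of volumes by countable subadditivity; the volume of the unit ball is a
  common factor.\<close>

lemma ball_not_covered_by_small_balls:
  fixes c :: "'a::euclidean_space"
  assumes N: "N \<in> null_sets lebesgue" and "\<And>i. 0 \<le> r i" "0 \<le> s"
    and sums: "summable (\<lambda>i. r i ^ DIM('a))" "(\<Sum>i. r i ^ DIM('a)) < s ^ DIM('a)"
  obtains y where "y \<in> ball c s" "y \<notin> N" "\<And>i::nat. y \<notin> ball (x i) (r i)"
proof -
  let ?v = "unit_ball_vol (real DIM('a))"
  have vol: "emeasure lebesgue (ball a t) = ennreal (?v * t ^ DIM('a))" if "0 \<le> t" for a :: 'a and t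
    using that by (simp add: emeasure_ball)
  have "\<not> ball c s \<subseteq> N \<union> (\<Union>i. ball (x i) (r i))"
  proof
    assume "ball c s \<subseteq> N \<union> (\<Union>i. ball (x i) (r i))"
    then have "emeasure lebesgue (ball c s) \<le> emeasure lebesgue (N \<union> (\<Union>i. ball (x i) (r i)))"
      using N by (intro emeasure_mono) auto
    also have "\<dots> = emeasure lebesgue (\<Union>i. ball (x i) (r i))"
      using N by (subst Un_commute, intro emeasure_Un_null_set) auto
    also have "\<dots> \<le> (\<Sum>i. emeasure lebesgue (ball (x i) (r i)))"
      by (intro emeasure_subadditive_countably) auto
    also have "\<dots> = (\<Sum>i. ennreal (?v * r i ^ DIM('a)))"
      using assms(2) by (simp only: vol)
    also have "\<dots> = ennreal (?v * (\<Sum>i. r i ^ DIM('a)))"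
      using assms by (subst suminf_ennreal2) (auto intro: summable_mult simp: suminf_mult)
    also have "\<dots> < ennreal (?v * s ^ DIM('a))"
      using assms by (intro ennreal_lessI mult_strict_left_mono mult_pos_pos)
        (auto intro!: order.strict_trans1[OF _ sums(2)] suminf_nonneg)
    finally show False using assms(3) by (simp only: vol less_irrefl)
  qed
  then show thesis using that by blast
qed

theorem theorem2:
  "\<exists>Z E :: (real ^ 2) set.
     - E \<in> null_sets lebesgue \<and>
     (\<forall>x\<in>E. differentiable_ae_direction (indicat_real Z) x) \<and>
     \<not> (\<exists>x. lipschitz_at_relative (indicat_real Z) x E)"
proof -

  \<comment> \<open>Construction of the balls and of the two sets\<close>
  obtain D :: "(real ^ 2) set" where D: "countable D" "\<And>X. open X \<Longrightarrow> X \<noteq> {} \<Longrightarrow> \<exists>d\<in>D. d \<in> X"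
    by (rule countable_dense_setE) blast
  define c where "c = from_nat_into D"
  have "D \<noteq> {}"
    using D(2)[of UNIV] by auto
  then have range_c: "range c = D"
    using D(1) by (simp add: c_def range_from_nat_into)
  have c_dense: "\<exists>k\<ge>n. c k \<in> V" if "open V" "V \<noteq> {}" for V n
  proof -
    have "infinite V"
      using that finite_imp_not_open by blast
    then have "V - c ` {..<n} \<noteq> {}"
      using finite_subset[of V "c ` {..<n}"] by auto
    moreover have "open (V - c ` {..<n})"
      using that by (intro open_Diff finite_imp_closed) auto
    ultimately obtain d where "d \<in> D" "d \<in> V - c ` {..<n}"
      using D(2) by blast
    moreover obtain k where "d = c k"
      using \<open>d \<in> D\<close> range_c by blast
    ultimately show ?thesis
      by (intro exI[of _ k]) auto
  qed
  obtain r :: "nat \<Rightarrow> real" where r_pos: "\<And>k. 0 < r k" and r_le: "\<And>k. r k \<le> (1/4) ^ k"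
    and r_decay: "\<And>j k. j < k \<Longrightarrow> r k \<le> r j * (1/4) ^ (k - j)"
    and r_sep: "\<And>j k. j < k \<Longrightarrow> 2 * r k < \<bar>dist (c k) (c j) - r j\<bar>"
    using exists_generic_radii[of c] by metis
  define B where "B k = ball (c k) (r k)" for k
  \<comment> \<open>An infinite index set has \<open>card\<close> 0, so points in infinitely many
    balls fall outside \<open>Z\<close>; points of \<open>E\<close> lie in finitely many
    only.\<close>
  define Z where "Z = {x. odd (card {k. x \<in> B k})}"
  \<comment> \<open>The threshold \<open>(1/2) ^ k\<close> is the square root of the bound on
    \<open>r k\<close>: the discs of this radius have summable areas, and beyond it the ratio of
    radius to distance is at most \<open>(1/2) ^ k\<close>, again summable.\<close>
  define E where "E = {x. finite {k. x \<in> ball (c k) ((1/2) ^ k)} \<and> (\<forall>k. x \<notin> sphere (c k) (r k))}"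
  have r_le': "r k \<le> (1/2) ^ k" for k
    using r_le[of k] power_mono[of "1/4::real" "1/2" k] by linarith

  \<comment> \<open>Borel-Cantelli in the plane\<close>
  have null: "- E \<in> null_sets lebesgue"
  proof -
    have "limsup (\<lambda>k. ball (c k) ((1/2) ^ k)) \<in> null_sets lebesgue"
    proof (rule borel_cantelli_limsup1)
      have "summable (\<lambda>k. unit_ball_vol 2 * (1/4::real) ^ k)"
        by (intro summable_mult summable_geometric) auto
      then show "summable (\<lambda>k. measure lebesgue (ball (c k) ((1/2) ^ k)))"
        by (simp add: content_ball power_mult_distrib power2_eq_square flip: power_mult_distrib)
    qed (auto simp: emeasure_ball)
    moreover have "(\<Union>k. sphere (c k) (r k)) \<in> null_sets lebesgue"
      using negligible_sphere by (intro null_sets_UN) (auto simp: negligible_iff_null_sets)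
    moreover have "- E = limsup (\<lambda>k. ball (c k) ((1/2) ^ k)) \<union> (\<Union>k. sphere (c k) (r k))"
      unfolding E_def limsup_INF_SUP by (auto simp: finite_nat_set_iff_bounded) (metis atLeast_iff not_less)+
    ultimately show ?thesis
      by (simp only: null_sets.Un)
  qed

  \<comment> \<open>Borel-Cantelli on the circle of directions\<close>
  have diff: "differentiable_ae_direction (indicat_real Z) x" if "x \<in> E" for x
  proof -
    let ?H = "\<lambda>u. {k. \<exists>h>0. x + h *\<^sub>R u \<in> B k}"
    have fin: "finite {k. x \<in> ball (c k) ((1/2) ^ k)}" and sph: "\<And>k. x \<notin> sphere (c k) (r k)"
      using \<open>x \<in> E\<close> by (auto simp: E_def)
    have fin_B: "finite {k. x \<in> B k}"
      by (rule finite_subset[OF _ fin]) (use order.strict_trans2[OF _ r_le'] in \<open>auto simp: B_def\<close>)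
    have "dir_differentiable (indicat_real Z) x u" if "finite (?H u)" for u
    proof -
      \<comment> \<open>Finiteness gives one range of \<open>h\<close> that serves all these balls.
        Any other ball contains neither \<open>x\<close> nor a point of the ray, so the whole index
        set stays constant.\<close>
      have "\<forall>\<^sub>F h in at_right 0. \<forall>k\<in>?H u \<union> {k. x \<in> B k}. x + h *\<^sub>R u \<in> B k \<longleftrightarrow> x \<in> B k"
        using that fin_B eventually_ray_mem_ball_iff[OF sph]
        by (intro eventually_ball_finite) (auto simp: B_def)
      moreover have "\<forall>\<^sub>F h::real in at_right 0. 0 < h"
        by (simp add: eventually_at_right_less)
      ultimately have "\<forall>\<^sub>F h in at_right 0.
          (indicat_real Z (x + h *\<^sub>R u) - indicat_real Z x) / h = 0"
      proof eventually_elim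
        case (elim h)
        then have "{k. x + h *\<^sub>R u \<in> B k} = {k. x \<in> B k}" by blast
        then show ?case by (simp add: Z_def indicator_def)
      qed
      then show ?thesis
        unfolding dir_differentiable_def by (blast intro: tendsto_eventually)
    qed
    moreover have "infinite {k. u \<in> cball (sgn (c k - x)) (2 * (1/2) ^ k)}"
      if "u \<in> sphere 0 1" "infinite (?H u)" for u
    proof -
      have "infinite (?H u - {k. x \<in> ball (c k) ((1/2) ^ k)})"
        using that fin by (intro Diff_infinite_finite)
      moreover have "u \<in> cball (sgn (c k - x)) (2 * (1/2) ^ k)"
        if k: "0 < h" "x + h *\<^sub>R u \<in> B k" "x \<notin> ball (c k) ((1/2) ^ k)" for h k
      proof -
        have d: "(1/2) ^ k \<le> dist x (c k)"
          using k(3) by (simp add: dist_commute)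
        moreover have "(0::real) < (1/2) ^ k" by simp
        ultimately have "0 < dist x (c k)" by linarith
        have "r k \<le> (1/2) ^ k * (1/2) ^ k"
          using r_le[of k] by (simp flip: power_mult_distrib)
        also have "\<dots> \<le> (1/2) ^ k * dist x (c k)"
          using d by (intro mult_left_mono) auto
        finally have "2 * r k / dist x (c k) \<le> 2 * (1/2) ^ k"
          using \<open>0 < dist x (c k)\<close> by (simp add: divide_le_eq)
        moreover have "u \<in> cball (sgn (c k - x)) (2 * r k / dist x (c k))"
          using k \<open>u \<in> sphere 0 1\<close> \<open>0 < dist x (c k)\<close>
          by (intro direction_hitting_ball[of u h]) (auto simp: B_def)
        ultimately show ?thesis by simp
      qed
      ultimately show ?thesis
        by (elim infinite_super[rotated]) blast
    qed
    ultimately show ?thesis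
      unfolding differentiable_ae_direction_def
      by (intro hausdorff1_limsup_cball_eq_0[where c = "\<lambda>k. sgn (c k - x)" and \<rho> = "\<lambda>k. 2 * (1/2) ^ k"]
          summable_mult summable_geometric) auto
  qed

  \<comment> \<open>Density of both values of the characteristic function on
    \<open>E\<close>\<close>
  have dense: "V \<inter> E \<inter> Z \<noteq> {} \<and> V \<inter> E - Z \<noteq> {}" if V: "open V" "V \<noteq> {}" for V
  proof -
    obtain a \<epsilon> where "0 < \<epsilon>" "ball a \<epsilon> \<subseteq> V"
      using V by (meson ex_in_conv open_contains_ball)
    have lim: "(\<lambda>k. 2 * (1/4::real) ^ k) \<longlonglongrightarrow> 2 * 0"
      by (intro tendsto_intros LIMSEQ_power_zero) auto
    have "\<forall>\<^sub>F k in sequentially. 2 * (1/4::real) ^ k < \<epsilon> / 2"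
      using order_tendstoD(2)[OF lim, of "\<epsilon> / 2"] \<open>0 < \<epsilon>\<close> by simp
    then obtain n where n: "\<And>k. k \<ge> n \<Longrightarrow> 2 * (1/4::real) ^ k < \<epsilon> / 2"
      by (auto simp: eventually_sequentially)
    obtain k where "k \<ge> n" "c k \<in> ball a (\<epsilon> / 2)"
      using c_dense[of "ball a (\<epsilon> / 2)" n] \<open>0 < \<epsilon>\<close> by auto
    then have "ball (c k) (2 * r k) \<subseteq> ball a \<epsilon>"
      using n[of k] r_le[of k] by (simp add: ball_subset_ball_iff dist_commute)
    with \<open>ball a \<epsilon> \<subseteq> V\<close> have sub: "ball (c k) (2 * r k) \<subseteq> V" by simp
    \<comment> \<open>The squared radii of the later balls are at most \<open>(r k)\<^sup>2\<close>
      times 1/16, 1/256, and so on. Their sum is at most \<open>(r k)\<^sup>2 / 15\<close>, less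
      than the \<open>(r k)\<^sup>2 / 4\<close> of the target ball.\<close>
    have pick: "\<exists>y\<in>E \<inter> ball b (r k / 2). \<forall>j>k. y \<notin> B j" for b
    proof -
      let ?g = "\<lambda>i. (r k)\<^sup>2 / 16 * (1/16) ^ i"
      have le: "(r (i + Suc k))\<^sup>2 \<le> ?g i" for i
      proof -
        have "(r (i + Suc k))\<^sup>2 \<le> (r k * (1/4) ^ Suc i)\<^sup>2"
          using r_decay[of k "i + Suc k"] r_pos[of "i + Suc k"] by (intro power_mono) auto
        also have "\<dots> = ?g i"
          by (simp add: power_mult_distrib power2_eq_square flip: power_mult_distrib)
        finally show ?thesis .
      qed
      have "?g sums ((r k)\<^sup>2 / 16 * (1 / (1 - 1/16)))"
        by (intro sums_mult geometric_sums) auto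
      then have g: "summable ?g" "suminf ?g = (r k)\<^sup>2 / 15"
        by (auto simp: sums_iff)
      have sm: "summable (\<lambda>i. (r (i + Suc k))\<^sup>2)"
        using le by (intro summable_comparison_test'[OF g(1), of 0]) auto
      have "(\<Sum>i. (r (i + Suc k))\<^sup>2) \<le> (r k)\<^sup>2 / 15"
        using suminf_le[OF le sm g(1)] g(2) by simp
      also have "\<dots> < (r k / 2)\<^sup>2"
        using r_pos[of k] by (simp add: power_divide)
      finally obtain y where "y \<in> ball b (r k / 2)" "y \<notin> - E"
          "\<And>i. y \<notin> ball (c (i + Suc k)) (r (i + Suc k))"
        using ball_not_covered_by_small_balls[OF null, of "\<lambda>i. r (i + Suc k)" "r k / 2" b "\<lambda>i. c (i + Suc k)"]
          sm r_pos by (auto simp: less_imp_le)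
      moreover from this(3) have "y \<notin> B j" if "j > k" for j
        using that by (metis B_def Suc_leI le_add_diff_inverse2)
      ultimately show ?thesis by blast
    qed
    let ?J = "{j. j < k \<and> c k \<in> B j}"
    have index: "{j. y \<in> B j} = (if y \<in> B k then insert k ?J else ?J)"
      if y: "y \<in> ball (c k) (2 * r k)" "\<forall>j>k. y \<notin> B j" for y
    proof -
      \<comment> \<open>The distances of \<open>y\<close> and \<open>c k\<close> to
        \<open>c j\<close> differ by less than \<open>2 * r k\<close>, hence by less than the gap
        between \<open>c k\<close> and the circle of \<open>B j\<close>: both points are on the same
        side.\<close>
      have "y \<in> B j \<longleftrightarrow> c k \<in> B j" if "j < k" for j
        using r_sep[OF that] y(1) dist_triangle[of "c j" y "c k"] dist_triangle[of "c j" "c k" y]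
        by (auto simp: B_def dist_commute)
      then show ?thesis
        using y(2) by (auto simp: not_less_iff_gr_or_eq) (metis linorder_neqE_nat)+
    qed
    obtain y where y: "y \<in> E" "y \<in> ball (c k) (r k / 2)" "\<forall>j>k. y \<notin> B j"
      using pick by blast
    \<comment> \<open>Since \<open>y\<close> lies in \<open>B k\<close> and \<open>k\<close> is not
      in \<open>?J\<close>, its index set has one element more than \<open>?J\<close>.\<close>
    have "y \<in> V" "y \<in> Z \<longleftrightarrow> even (card ?J)"
      using y r_pos[of k] index[of y] sub by (auto simp: Z_def B_def)
    \<comment> \<open>The ball of radius \<open>r k / 2\<close> around \<open>c k + e\<close> fits between the two concentric circles.\<close>
    obtain e :: "real ^ 2" where e: "norm e = 3/2 * r k"
      using vector_choose_size[of "3/2 * r k"] r_pos[of k] by auto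
    obtain z where z: "z \<in> E" "z \<in> ball (c k + e) (r k / 2)" "\<forall>j>k. z \<notin> B j"
      using pick by blast
    have "dist (c k) (c k + e) = 3/2 * r k"
      using e by (simp add: dist_norm)
    then have "dist (c k) z < 2 * r k" "r k < dist (c k) z"
      using z(2) dist_triangle[of "c k" z "c k + e"] dist_triangle[of "c k" "c k + e" z]
      by (auto simp: dist_commute)
    then have "z \<in> V" "z \<in> Z \<longleftrightarrow> odd (card ?J)"
      using z index[of z] sub by (auto simp: Z_def B_def)
    then show ?thesis
      using \<open>y \<in> V\<close> \<open>y \<in> Z \<longleftrightarrow> even (card ?J)\<close> y(1) z(1) by blast
  qed

  show ?thesis
    using null diff not_lipschitz_at_relative_if_dense[OF dense] by blast
qed

end
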